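(* Let $\mathcal{H}$ be a non-trivial complex Hilbert space, let $A\neq 0$ be a positive operator on $\mathcal{H}$, and let $T\in \mathcal{B}_{A^{1/2}}(\mathcal{H})$ be an $A$-normaloid operator. Then $$r_A(T)=\omega_A(T)=\|T\|_A.$$
   Context: $\mathcal{B}(\mathcal{H})$ is the algebra of bounded linear operators on $\mathcal{H}$; inner product $\langle\cdot\mid\cdot\rangle$. $A\in\mathcal{B}(\mathcal{H})$ is positive if $\langle Ax\mid x\rangle\ge 0$ for all $x\in\mathcal{H}$. Put $\langle x\mid y\rangle_A:=\langle Ax\mid y\rangle$ and $\|x\|_A:=\langle x\mid x\rangle_A^{1/2}$ (a seminorm). $\mathcal{B}_{A^{1/2}}(\mathcal{H})$ is the set of $A$-bounded operators: those $T\in\mathcal{B}(\mathcal{H})$ for which there is $\lambda>0$ with $\|Tx\|_A\le\lambda\|x\|_A$ for all $x\in\mathcal{H}$. For such $T$, $\|T\|_A:=\sup\{\|Tx\|_A/\|x\|_A : x\in\overline{\mathcal{R}(A)},\ x\neq 0\}$, where $\mathcal{R}(A)$ is the range of $A$ (closure in the norm of $\mathcal{H}$). The $A$-spectral radius of $T\in\mathcal{B}_{A^{1/2}}(\mathcal{H})$ is $r_A(T):=\inf_{n\in\mathbb{N}^*}\|T^n\|_A^{1/n}$, with $\mathbb{N}^*$ the set of positive integers. The $A$-numerical radius is $\omega_A(T):=\sup\{|\langle Tx\mid x\rangle_A| : x\in\mathcal{H},\ \|x\|_A=1\}$. An operator $T\in\mathcal{B}_{A^{1/2}}(\mathcal{H})$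 is $A$-normaloid if $r_A(T)=\|T\|_A$. *)

theory Defs
  imports "HOL-Analysis.Analysis"
begin

class complex_inner = real_normed_vector +
  fixes scaleC :: "complex \<Rightarrow> 'a \<Rightarrow> 'a" (infixr \<open>*\<^sub>C\<close> 75)
    and cinner :: "'a \<Rightarrow> 'a \<Rightarrow> complex"
  assumes scaleC_add_right: "c *\<^sub>C (x + y) = c *\<^sub>C x + c *\<^sub>C y"
    and scaleC_add_left: "(c + d) *\<^sub>C x = c *\<^sub>C x + d *\<^sub>C x"
    and scaleC_scaleC: "c *\<^sub>C (d *\<^sub>C x) = (c * d) *\<^sub>C x"
    and scaleC_of_real: "complex_of_real r *\<^sub>C x = r *\<^sub>R x"
    and cinner_commute: "cinner x y = cnj (cinner y x)"
    and cinner_add_left: "cinner (x + y) z = cinner x z + cinner y z"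
    and cinner_scaleC_left: "cinner (c *\<^sub>C x) y = c * cinner x y"
    and cinner_self_nonneg: "cinner x x \<in> \<real>\<^sub>\<ge>\<^sub>0"
    and cinner_eq_zero_iff: "cinner x x = 0 \<longleftrightarrow> x = 0"
    and norm_eq_sqrt_cinner: "norm x = sqrt (Re (cinner x x))"

class chilbert_space = complex_inner + complete_space

definition bounded_ops :: "('a::complex_inner \<Rightarrow> 'a) set" where
  "bounded_ops = {T. bounded_linear T \<and> (\<forall>c x. T (c *\<^sub>C x) = c *\<^sub>C T x)}"

definition positive_op :: "('a::complex_inner \<Rightarrow> 'a) \<Rightarrow> bool" where
  "positive_op A \<longleftrightarrow> A \<in> bounded_ops \<and> (\<forall>x. cinner (A x) x \<in> \<real>\<^sub>\<ge>\<^sub>0)"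

definition A_inner :: "('a::complex_inner \<Rightarrow> 'a) \<Rightarrow> 'a \<Rightarrow> 'a \<Rightarrow> complex" where
  "A_inner A x y = cinner (A x) y"

definition A_seminorm :: "('a::complex_inner \<Rightarrow> 'a) \<Rightarrow> 'a \<Rightarrow> real" where
  "A_seminorm A x = sqrt (Re (A_inner A x x))"

definition A_bounded_ops :: "('a::complex_inner \<Rightarrow> 'a) \<Rightarrow> ('a \<Rightarrow> 'a) set" where
  "A_bounded_ops A =
    {T \<in> bounded_ops. \<exists>l>0. \<forall>x. A_seminorm A (T x) \<le> l * A_seminorm A x}"

(* The suprema and infima below are taken in real. For positive A \<noteq> 0 and
   A-bounded T they range over nonempty sets bounded on the relevant side.
   The quotient in A_opnorm never divides by zero: for positive A the seminorm
   vanishes exactly on the kernel of A, which meets closure (range A) only in 0. *)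

definition A_opnorm :: "('a::complex_inner \<Rightarrow> 'a) \<Rightarrow> ('a \<Rightarrow> 'a) \<Rightarrow> real" where
  "A_opnorm A T =
    Sup {A_seminorm A (T x) / A_seminorm A x | x. x \<in> closure (range A) \<and> x \<noteq> 0}"

definition A_spectral_radius :: "('a::complex_inner \<Rightarrow> 'a) \<Rightarrow> ('a \<Rightarrow> 'a) \<Rightarrow> real" where
  "A_spectral_radius A T = (INF n\<in>{1::nat..}. root n (A_opnorm A (T ^^ n)))"

definition A_numerical_radius :: "('a::complex_inner \<Rightarrow> 'a) \<Rightarrow> ('a \<Rightarrow> 'a) \<Rightarrow> real" where
  "A_numerical_radius A T = Sup {cmod (A_inner A (T x) x) | x. A_seminorm A x = 1}"

definition A_normaloid :: "('a::complex_inner \<Rightarrow> 'a) \<Rightarrow> ('a \<Rightarrow> 'a) \<Rightarrow> bool" where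
  "A_normaloid A T \<longleftrightarrow> T \<in> A_bounded_ops A \<and> A_spectral_radius A T = A_opnorm A T"

end

theory Submission
  imports Defs
begin

text \<open>
  In general \<open>r\<^sub>A(T) \<le> \<omega>\<^sub>A(T) \<le> \<parallel>T\<parallel>\<^sub>A\<close>; for an \<open>A\<close>-normaloid operator the two ends agree.
  The upper bound is the Cauchy-Schwarz inequality together with
  \<open>\<parallel>Tx\<parallel>\<^sub>A \<le> \<parallel>T\<parallel>\<^sub>A \<parallel>x\<parallel>\<^sub>A\<close> for all \<open>x\<close>. As the norm only tests vectors in the closed range of \<open>A\<close>,
  this needs the range of \<open>A\<close> to be dense for the \<open>A\<close>-seminorm: the iterates
  \<open>y \<mapsto> y - cAy\<close> started at \<open>x\<close> stay in \<open>x + \<R>(A)\<close>, and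
  \<open>\<parallel>y - cAy\<parallel>\<^sup>2 \<le> \<parallel>y\<parallel>\<^sup>2 - c\<parallel>y\<parallel>\<^sub>A\<^sup>2\<close> for small \<open>c > 0\<close> forces their \<open>A\<close>-seminorms to tend to zero.
  For the lower bound, \<open>\<omega>\<^sub>A(T\<^sup>2) \<le> \<omega>\<^sub>A(T)\<^sup>2\<close> and \<open>\<parallel>S\<parallel>\<^sub>A \<le> 2\<omega>\<^sub>A(S)\<close> yield
  \<open>r\<^sub>A(T)\<^sup>n \<le> \<parallel>T\<^sup>n\<parallel>\<^sub>A \<le> 2\<omega>\<^sub>A(T)\<^sup>n\<close> for all powers \<open>n\<close> of two.
\<close>

section \<open>Inner-product algebra, bounded operators and two scalar lemmas\<close>

lemma scaleC_uminus_one: "(-1) *\<^sub>C (x::'a::complex_inner) = - x"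
  using scaleC_of_real[of "-1" x] by simp

lemma cinner_add_right: "cinner (x::'a::complex_inner) (y + z) = cinner x y + cinner x z"
  by (metis cinner_add_left cinner_commute complex_cnj_add)

lemma cinner_scaleC_right: "cinner (x::'a::complex_inner) (c *\<^sub>C y) = cnj c * cinner x y"
  by (metis cinner_commute cinner_scaleC_left complex_cnj_mult)

lemma bounded_ops_add: "T \<in> bounded_ops \<Longrightarrow> T (x + y) = T x + T y"
  and bounded_ops_diff: "T \<in> bounded_ops \<Longrightarrow> T (x - y) = T x - T y"
  and bounded_ops_scaleC: "T \<in> bounded_ops \<Longrightarrow> T (c *\<^sub>C x) = c *\<^sub>C T x"
  and bounded_ops_scaleR: "T \<in> bounded_ops \<Longrightarrow> T (r *\<^sub>R x) = r *\<^sub>R T x"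
  by (auto simp: bounded_ops_def linear_simps)

lemma bounded_ops_funpow: "T \<in> bounded_ops \<Longrightarrow> T ^^ n \<in> bounded_ops"
proof (induction n)
  case 0
  then show ?case by (simp add: bounded_ops_def id_def)
next
  case (Suc n)
  then show ?case
    by (auto simp: bounded_ops_def bounded_linear_compose o_def)
qed

text \<open>If \<open>a / b > 1\<close>, its powers exceed every constant. This removes the factor 2
  lost in passing from numerical bounds to norm bounds.\<close>

lemma power_bound_imp_le:
  fixes a b c :: real
  assumes "0 < b" and le: "\<And>k. a ^ (2 ^ k) \<le> c * b ^ (2 ^ k)"
  shows "a \<le> b"
proof (rule ccontr)
  assume "\<not> a \<le> b"
  hence gt: "a / b > 1" using \<open>0 < b\<close> by simp
  then obtain n where n: "c < (a / b) ^ n" using real_arch_pow by blast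
  have "(a / b) ^ n \<le> (a / b) ^ (2 ^ n)"
    using gt by (intro power_increasing) (auto intro: less_imp_le less_exp)
  also have "\<dots> \<le> c"
    using le[of n] \<open>0 < b\<close> by (simp add: power_divide divide_simps)
  finally show False using n by simp
qed

lemma exists_rotation: "\<exists>u::complex. cmod u = 1 \<and> Re (u * z) = cmod z"
proof (cases "z = 0")
  case True
  then show ?thesis by (intro exI[of _ 1]) simp
next
  case False
  have "cnj (sgn z) * z = of_real (cmod z)"
    using False by (simp add: sgn_eq complex_norm_square[symmetric] mult.commute
        power2_eq_square field_simps)
  then show ?thesis using False
    by (intro exI[of _ "cnj (sgn z)"]) (simp add: norm_sgn)
qed

section \<open>The semi-inner product of a positive operator\<close>

locale positive_operator =
  fixes A :: "'a::complex_inner \<Rightarrow> 'a"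
  assumes pos: "positive_op A"
begin

abbreviation q :: "'a \<Rightarrow> 'a \<Rightarrow> complex" where "q \<equiv> A_inner A"

abbreviation sn :: "'a \<Rightarrow> real" where "sn \<equiv> A_seminorm A"

lemma A_bounded_op: "A \<in> bounded_ops"
  using pos by (simp add: positive_op_def)

lemma q_add_left: "q (x + y) z = q x z + q y z"
  by (simp add: A_inner_def bounded_ops_add[OF A_bounded_op] cinner_add_left)

lemma q_scaleC_left: "q (c *\<^sub>C x) z = c * q x z"
  by (simp add: A_inner_def bounded_ops_scaleC[OF A_bounded_op] cinner_scaleC_left)

lemma q_add_right: "q x (y + z) = q x y + q x z"
  by (simp add: A_inner_def cinner_add_right)

lemma q_scaleC_right: "q x (c *\<^sub>C z) = cnj c * q x z"
  by (simp add: A_inner_def cinner_scaleC_right)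

lemma q_scaleR_left: "q (r *\<^sub>R x) z = of_real r * q x z"
  and q_scaleR_right: "q x (r *\<^sub>R z) = of_real r * q x z"
  by (simp_all flip: scaleC_of_real add: q_scaleC_left q_scaleC_right)

lemma q_minus_left: "q (- x) z = - q x z"
  and q_minus_right: "q x (- z) = - q x z"
  by (simp_all flip: scaleC_uminus_one add: q_scaleC_left q_scaleC_right)

lemma q_diff_left: "q (x - y) z = q x z - q y z"
  using q_add_left[of x "- y" z] by (simp add: q_minus_left)

lemma q_diff_right: "q x (y - z) = q x y - q x z"
  using q_add_right[of x y "- z"] by (simp add: q_minus_right)

lemmas q_simps = q_add_left q_add_right q_diff_left q_diff_right
  q_scaleC_left q_scaleC_right q_scaleR_left q_scaleR_right

lemma q_self_nonneg: "Re (q x x) \<ge> 0" and q_self_real: "Im (q x x) = 0"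
  using pos by (auto simp: positive_op_def A_inner_def complex_nonneg_Reals_iff)

text \<open>Hermitian symmetry is forced by reality of the quadratic form: \<open>x + y\<close>
  gives the imaginary parts, \<open>x + \<i> *\<^sub>C y\<close> the real parts.\<close>

lemma q_commute: "q x y = cnj (q y x)"
proof -
  have "Im (q x y) + Im (q y x) = 0"
    using q_self_real[of "x + y"] by (simp add: q_simps q_self_real)
  moreover have "Re (q y x) - Re (q x y) = 0"
    using q_self_real[of "x + \<i> *\<^sub>C y"] by (simp add: q_simps q_self_real)
  ultimately show ?thesis by (simp add: complex_eq_iff)
qed

lemma sn_sq: "(sn x)\<^sup>2 = Re (q x x)"
  by (simp add: A_seminorm_def q_self_nonneg)

lemma sn_nonneg: "sn x \<ge> 0"
  by (simp add: A_seminorm_def q_self_nonneg)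

lemma sn_scaleR: "sn (r *\<^sub>R x) = \<bar>r\<bar> * sn x"
  by (simp add: A_seminorm_def q_simps real_sqrt_mult flip: mult.assoc)

lemma A_Cauchy_Schwarz: "cmod (q x y) \<le> sn x * sn y"
proof -
  obtain u where u: "cmod u = 1" "Re (u * q x y) = cmod (q x y)"
    using exists_rotation by blast
  define m where "m = cmod (q x y)"
  have uu: "u * cnj u = 1" using u(1) by (simp flip: complex_norm_square)
  define z where "z = u *\<^sub>C x"
  have zz: "q z z = q x x"
    using uu by (simp add: z_def q_simps mult.assoc[symmetric] mult.commute[of "cnj u"])
  have zy: "Re (q z y) = m" "Re (q y z) = m"
    using u(2) arg_cong[OF q_commute[of y z], of Re]
    by (simp_all add: z_def q_scaleC_left m_def)
  have quad: "0 \<le> s\<^sup>2 * (sn x)\<^sup>2 - 2 * s * t * m + t\<^sup>2 * (sn y)\<^sup>2" for s t :: real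
    using q_self_nonneg[of "s *\<^sub>R z - t *\<^sub>R y"]
    unfolding sn_sq by (simp add: q_simps zz zy power2_eq_square algebra_simps)
  \<comment> \<open>The natural choice \<open>s = sn y\<close>, \<open>t = sn x\<close> in
    \<open>quad\<close> could vanish, since \<open>sn\<close> is only a seminorm. Shifting both by
    \<open>e > 0\<close> allows the division; then \<open>e\<close> tends to 0.\<close>
  have *: "m \<le> (sn x + e) * (sn y + e)" if "e > 0" for e
  proof -
    have pos: "sn x + e > 0" "sn y + e > 0"
      using that sn_nonneg[of x] sn_nonneg[of y] by linarith+
    have "2 * ((sn y + e) * (sn x + e)) * m \<le> (sn y + e)\<^sup>2 * (sn x)\<^sup>2 + (sn x + e)\<^sup>2 * (sn y)\<^sup>2"
      using quad[of "sn y + e" "sn x + e"] by (simp add: algebra_simps)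
    also have "\<dots> \<le> (sn y + e)\<^sup>2 * (sn x + e)\<^sup>2 + (sn x + e)\<^sup>2 * (sn y + e)\<^sup>2"
      using that by (intro add_mono mult_left_mono power_mono) (auto simp: sn_nonneg)
    also have "\<dots> = 2 * ((sn y + e) * (sn x + e)) * ((sn x + e) * (sn y + e))"
      by (simp add: power2_eq_square algebra_simps)
    finally show ?thesis
      using pos by simp
  qed
  have "((\<lambda>e. (sn x + e) * (sn y + e)) \<longlongrightarrow> (sn x + 0) * (sn y + 0)) (at_right 0)"
    by (intro tendsto_intros)
  moreover have "eventually (\<lambda>e. m \<le> (sn x + e) * (sn y + e)) (at_right 0)"
    using * by (auto simp: eventually_at_right_field intro: exI[of _ 1])
  ultimately have "m \<le> (sn x + 0) * (sn y + 0)"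
    by (intro tendsto_lowerbound) auto
  then show ?thesis by (simp add: m_def)
qed

lemma sn_triangle: "sn (x + y) \<le> sn x + sn y"
proof (rule power2_le_imp_le)
  have "(sn (x + y))\<^sup>2 = (sn x)\<^sup>2 + (sn y)\<^sup>2 + 2 * Re (q x y)"
    using q_commute[of y x] by (simp add: sn_sq q_simps)
  also have "\<dots> \<le> (sn x + sn y)\<^sup>2"
    using A_Cauchy_Schwarz[of x y] complex_Re_le_cmod[of "q x y"]
    by (simp add: power2_sum)
  finally show "(sn (x + y))\<^sup>2 \<le> (sn x + sn y)\<^sup>2" .
qed (simp add: sn_nonneg)

section \<open>Numerical bounds for powers and for the seminorm\<close>

text \<open>Pearcy's argument for the power inequality, in the case of squares: for
  \<open>y\<^sub>\<plusminus> = wx \<plusminus> Sx\<close> the vector \<open>v = w\<^sup>2x - S\<^sup>2x\<close> equals both \<open>wy\<^sub>+ - Sy\<^sub>+\<close> and \<open>wy\<^sub>- + Sy\<^sub>-\<close>,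
  and \<open>y\<^sub>+ + y\<^sub>- = 2wx\<close>.\<close>

lemma numerical_bound_square:
  assumes T: "T \<in> bounded_ops" and "w > 0"
    and le: "\<And>x. cmod (q (T x) x) \<le> w * (sn x)\<^sup>2"
  shows "cmod (q (T (T x)) x) \<le> w\<^sup>2 * (sn x)\<^sup>2"
proof -
  obtain c where c: "cmod c = 1" "Re (c * q (T (T x)) x) = cmod (q (T (T x)) x)"
    using exists_rotation by blast
  \<comment> \<open>A square root of the rotation \<open>c\<close> makes \<open>S = uT\<close>
    satisfy \<open>S\<^sup>2 = cT\<^sup>2\<close>, while \<open>cmod u = 1\<close> keeps the
    numerical bound of \<open>T\<close>.\<close>
  define u where "u = csqrt c"
  have uu: "u * u = c" by (simp add: u_def flip: power2_eq_square)
  have u1: "cmod u = 1" using c(1) by (simp add: u_def)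
  define S where "S = (\<lambda>y. u *\<^sub>C T y)"
  have S_add: "S (y + z) = S y + S z" and S_scaleR: "S (r *\<^sub>R y) = r *\<^sub>R S y" for y z r
    by (simp_all add: S_def bounded_ops_add[OF T] bounded_ops_scaleC[OF T] scaleC_add_right
        scaleC_scaleC mult.commute flip: scaleC_of_real)
  have S_diff: "S (y - z) = S y - S z" for y z
    using S_add[of "y - z" z] by (simp add: algebra_simps)
  have S_le: "\<bar>Re (q (S y) y)\<bar> \<le> w * Re (q y y)" for y
    using abs_Re_le_cmod[of "q (S y) y"] le[of y] u1
    by (simp add: S_def q_simps norm_mult sn_sq)
  have SS: "Re (q (S (S x)) x) = cmod (q (T (T x)) x)"
    using c(2) by (simp add: S_def bounded_ops_scaleC[OF T] scaleC_scaleC uu q_simps)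
  define v yp ym where "v = (w * w) *\<^sub>R x - S (S x)"
    and "yp = w *\<^sub>R x + S x" and "ym = w *\<^sub>R x - S x"
  have vp: "v = w *\<^sub>R yp - S yp" and vm: "v = w *\<^sub>R ym + S ym"
    by (simp_all add: v_def yp_def ym_def S_add S_diff S_scaleR algebra_simps)
  have "Re (q v yp) \<ge> 0"
    unfolding vp using S_le[of yp] by (simp add: q_simps)
  moreover have "Re (q v ym) \<ge> 0"
    unfolding vm using S_le[of ym] by (simp add: q_simps)
  moreover have "Re (q v yp) + Re (q v ym) = 2 * w * Re (q v x)"
    by (simp add: yp_def ym_def q_simps)
  ultimately have "0 \<le> 2 * w * Re (q v x)" by linarith
  hence "Re (q v x) \<ge> 0" using \<open>w > 0\<close> by (simp add: zero_le_mult_iff)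
  then show ?thesis
    by (simp add: v_def q_simps SS flip: sn_sq power2_eq_square)
qed

lemma numerical_bound_power:
  assumes T: "T \<in> bounded_ops" and "w > 0"
    and le: "\<And>x. cmod (q (T x) x) \<le> w * (sn x)\<^sup>2"
  shows "cmod (q ((T ^^ (2 ^ k)) x) x) \<le> w ^ (2 ^ k) * (sn x)\<^sup>2"
proof (induction k arbitrary: x)
  case 0
  then show ?case using le by simp
next
  case (Suc k)
  have "T ^^ (2 ^ Suc k) = (T ^^ (2 ^ k)) \<circ> (T ^^ (2 ^ k))"
    by (simp add: mult_2 funpow_add)
  moreover have "w ^ (2 ^ Suc k) = (w ^ (2 ^ k))\<^sup>2"
    by (simp add: power_mult mult.commute flip: power_mult)
  ultimately show ?case
    using numerical_bound_square[OF bounded_ops_funpow[OF T] _ Suc.IH] \<open>w > 0\<close> by simp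
qed

text \<open>Polarization writes \<open>4 * Re (q (T x) y)\<close> through the form of
  \<open>T\<close> at \<open>x \<plusminus> y\<close> and \<open>x \<plusminus> \<i>y\<close>; the
  parallelogram law sums the four bounds.\<close>

lemma norm_le_twice_numerical_bound:
  assumes T: "T \<in> bounded_ops" and "w > 0"
    and le: "\<And>x. cmod (q (T x) x) \<le> w * (sn x)\<^sup>2"
  shows "sn (T x) \<le> 2 * w * sn x"
proof -
  \<comment> \<open>Among \<open>y = t *\<^sub>R T x\<close>, the factor
    \<open>t = 1 / (2 * w)\<close> maximizes \<open>t - w * t\<^sup>2\<close> and so gives the best
    bound.\<close>
  define y where "y = (1 / (2 * w)) *\<^sub>R T x"
  have le': "\<bar>Re (q (T z) z)\<bar> \<le> w * Re (q z z)" for z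
    using le[of z] abs_Re_le_cmod[of "q (T z) z"] by (simp add: sn_sq)
  have im: "\<bar>Im (q (T z) z)\<bar> \<le> w * Re (q z z)" for z
    using le[of z] abs_Im_le_cmod[of "q (T z) z"] by (simp add: sn_sq)
  have "4 * Re (q (T x) y) \<le> 4 * w * (Re (q x x) + Re (q y y))"
    using le'[of "x + y"] le'[of "x - y"] im[of "x + \<i> *\<^sub>C y"] im[of "x - \<i> *\<^sub>C y"]
    by (simp add: q_simps bounded_ops_add[OF T] bounded_ops_diff[OF T]
        bounded_ops_scaleC[OF T] algebra_simps)
  moreover have "Re (q (T x) y) = (sn (T x))\<^sup>2 / (2 * w)"
    and "Re (q y y) = (sn (T x))\<^sup>2 / (2 * w)\<^sup>2"
    unfolding sn_sq by (simp_all add: y_def q_simps power2_eq_square)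
  ultimately have "(sn (T x))\<^sup>2 \<le> (2 * w * sn x)\<^sup>2"
    using \<open>w > 0\<close> unfolding sn_sq[of x, symmetric] by (simp add: field_simps power2_eq_square)
  then show ?thesis
    by (rule power2_le_imp_le) (use \<open>w > 0\<close> sn_nonneg in simp)
qed

end

section \<open>The ambient inner product as the case of the identity operator\<close>

lemma positive_operator_id: "positive_operator (\<lambda>x::'a::complex_inner. x)"
  by unfold_locales (simp add: positive_op_def bounded_ops_def cinner_self_nonneg)

lemma cinner_Cauchy_Schwarz: "cmod (cinner x y) \<le> norm x * norm (y::'a::complex_inner)"
  using positive_operator.A_Cauchy_Schwarz[OF positive_operator_id, of x y]
  by (simp add: A_seminorm_def A_inner_def norm_eq_sqrt_cinner)

lemma norm_sq_cinner: "(norm (x::'a::complex_inner))\<^sup>2 = Re (cinner x x)"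
  using positive_operator.sn_sq[OF positive_operator_id, of x]
  by (simp add: A_seminorm_def A_inner_def norm_eq_sqrt_cinner)

lemma norm_sq_diff_scaleR:
  "(norm (x - r *\<^sub>R (y::'a::complex_inner)))\<^sup>2
    = (norm x)\<^sup>2 - 2 * r * Re (cinner y x) + r\<^sup>2 * (norm y)\<^sup>2"
proof -
  note simps = positive_operator.q_simps[OF positive_operator_id, unfolded A_inner_def]
  have "Re (cinner x y) = Re (cinner y x)"
    using cinner_commute[of x y] by simp
  then show ?thesis
    unfolding norm_sq_cinner by (simp add: simps power2_eq_square algebra_simps)
qed

section \<open>Density of the range in the seminorm, and the kernel\<close>

context positive_operator
begin

text \<open>Since \<open>q y (A y)\<close> is the squared norm of \<open>A y\<close>, Cauchy-Schwarz
  bounds it by \<open>sn y * sn (A y)\<close>. Boundedness of \<open>A\<close> controls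
  \<open>sn (A y)\<close> by \<open>norm (A y)\<close>; squaring and cancelling finishes.\<close>

lemma norm_A_sq_le: "\<exists>K>0. \<forall>y. (norm (A y))\<^sup>2 \<le> K * (sn y)\<^sup>2"
proof -
  have "bounded_linear A" using A_bounded_op by (simp add: bounded_ops_def)
  then obtain K where K: "K > 0" "\<And>x. norm (A x) \<le> norm x * K"
    using bounded_linear.pos_bounded by blast
  have "(norm (A y))\<^sup>2 \<le> K * (sn y)\<^sup>2" for y
  proof (cases "A y = 0")
    case False
    have "(sn (A y))\<^sup>2 \<le> norm (A (A y)) * norm (A y)"
      using cinner_Cauchy_Schwarz[of "A (A y)" "A y"] complex_Re_le_cmod[of "q (A y) (A y)"]
      by (simp add: sn_sq A_inner_def)
    also have "\<dots> \<le> K * (norm (A y))\<^sup>2"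
      using mult_right_mono[OF K(2)[of "A y"], of "norm (A y)"]
      by (simp add: power2_eq_square algebra_simps)
    finally have *: "(sn (A y))\<^sup>2 \<le> K * (norm (A y))\<^sup>2" .
    have "(norm (A y))\<^sup>2 \<le> sn y * sn (A y)"
      using A_Cauchy_Schwarz[of y "A y"] complex_Re_le_cmod[of "q y (A y)"]
      by (simp add: norm_sq_cinner A_inner_def)
    hence "((norm (A y))\<^sup>2)\<^sup>2 \<le> (sn y)\<^sup>2 * (sn (A y))\<^sup>2"
      unfolding power_mult_distrib[symmetric] by (intro power_mono) auto
    also have "\<dots> \<le> (sn y)\<^sup>2 * (K * (norm (A y))\<^sup>2)"
      using * by (intro mult_left_mono) auto
    finally have "(norm (A y))\<^sup>2 * (norm (A y))\<^sup>2 \<le> (norm (A y))\<^sup>2 * (K * (sn y)\<^sup>2)"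
      by (simp add: power2_eq_square algebra_simps)
    then show ?thesis using False by (subst (asm) mult_le_cancel_left_pos) simp_all
  qed (simp add: K(1) less_imp_le)
  then show ?thesis using K(1) by blast
qed

lemma range_dense:
  assumes "e > 0"
  shows "\<exists>z. sn (x - A z) < e"
proof (rule ccontr)
  assume "\<not> ?thesis"
  hence ge: "e \<le> sn (x - A z)" for z by (auto simp: not_less)
  obtain K where K: "K > 0" "\<And>y. (norm (A y))\<^sup>2 \<le> K * (sn y)\<^sup>2"
    using norm_A_sq_le by blast
  \<comment> \<open>With step size \<open>1 / K\<close> the cross term contributes
    \<open>-2 * (sn y)\<^sup>2 / K\<close>, and the choice of \<open>K\<close> lets the quadratic
    term restore at most half of it.\<close>
  have step: "(norm (y - (1 / K) *\<^sub>R A y))\<^sup>2 \<le> (norm y)\<^sup>2 - (sn y)\<^sup>2 / K" for y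
  proof -
    have "(1 / K)\<^sup>2 * (norm (A y))\<^sup>2 \<le> (sn y)\<^sup>2 / K"
      using K(1) K(2)[of y] by (simp add: field_simps power2_eq_square)
    then show ?thesis
      unfolding norm_sq_diff_scaleR by (simp add: sn_sq A_inner_def field_simps)
  qed
  \<comment> \<open>If \<open>sn\<close> stays at least \<open>e\<close> on \<open>x - A z\<close>,
    every step lowers the squared norm by at least \<open>e\<^sup>2 / K\<close>, which would
    eventually make it negative.\<close>
  have ex: "\<exists>z. (norm (x - A z))\<^sup>2 \<le> (norm x)\<^sup>2 - real n * (e\<^sup>2 / K)" for n
  proof (induction n)
    case 0
    have "A 0 = 0" using bounded_ops_diff[OF A_bounded_op, of 0 0] by simp
    then show ?case by (intro exI[of _ 0]) simp
  next
    case (Suc n)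
    then obtain z where z: "(norm (x - A z))\<^sup>2 \<le> (norm x)\<^sup>2 - real n * (e\<^sup>2 / K)" by blast
    define z' where "z' = z + (1 / K) *\<^sub>R (x - A z)"
    have "x - A z' = (x - A z) - (1 / K) *\<^sub>R A (x - A z)"
      by (simp add: z'_def bounded_ops_add[OF A_bounded_op] bounded_ops_scaleR[OF A_bounded_op])
    hence "(norm (x - A z'))\<^sup>2 \<le> (norm (x - A z))\<^sup>2 - (sn (x - A z))\<^sup>2 / K"
      by (simp only: step)
    moreover have "e\<^sup>2 / K \<le> (sn (x - A z))\<^sup>2 / K"
      using ge[of z] \<open>e > 0\<close> K(1) by (intro divide_right_mono power_mono) auto
    ultimately have "(norm (x - A z'))\<^sup>2 \<le> (norm x)\<^sup>2 - real (Suc n) * (e\<^sup>2 / K)"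
      using z unfolding of_nat_Suc distrib_right by linarith
    then show ?case by blast
  qed
  have "e\<^sup>2 / K > 0" using \<open>e > 0\<close> K(1) by simp
  then obtain n where "(norm x)\<^sup>2 < real n * (e\<^sup>2 / K)"
    using reals_Archimedean3 by blast
  moreover obtain z where "(norm (x - A z))\<^sup>2 \<le> (norm x)\<^sup>2 - real n * (e\<^sup>2 / K)"
    using ex by blast
  ultimately show False using zero_le_power2[of "norm (x - A z)"] by linarith
qed

lemma sn_zero_imp_A_zero:
  assumes "sn x = 0"
  shows "A x = 0"
proof -
  obtain K where "(norm (A x))\<^sup>2 \<le> K * (sn x)\<^sup>2" using norm_A_sq_le by blast
  then show ?thesis using assms by simp
qed

lemma A_bounded_ops_funpow:
  assumes "T \<in> A_bounded_ops A"
  shows "T ^^ n \<in> A_bounded_ops A"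
proof -
  obtain l where T: "T \<in> bounded_ops" and l: "l > 0" "\<And>x. sn (T x) \<le> l * sn x"
    using assms by (auto simp: A_bounded_ops_def)
  have "sn ((T ^^ n) x) \<le> l ^ n * sn x" for x
  proof (induction n)
    case (Suc n)
    have "sn ((T ^^ Suc n) x) \<le> l * sn ((T ^^ n) x)" using l(2) by simp
    also have "\<dots> \<le> l * (l ^ n * sn x)"
      using Suc l(1) by (intro mult_left_mono) auto
    finally show ?case by (simp add: mult.assoc)
  qed simp
  then show ?thesis
    using bounded_ops_funpow[OF T] l(1) by (auto simp: A_bounded_ops_def intro!: exI[of _ "l ^ n"])
qed

end

section \<open>Operator norm, numerical radius and spectral radius\<close>

locale nonzero_positive_operator = positive_operator A for A :: "'a::complex_inner \<Rightarrow> 'a" +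
  assumes nonzero: "A \<noteq> (\<lambda>x. 0)"
begin

lemma exists_range_nonzero: "\<exists>x. x \<in> closure (range A) \<and> x \<noteq> 0"
proof -
  obtain z where "A z \<noteq> 0" using nonzero by blast
  moreover have "A z \<in> closure (range A)"
    using closure_subset by (rule subsetD) (rule rangeI)
  ultimately show ?thesis by blast
qed

lemma exists_sn_one: "\<exists>x. sn x = 1"
proof -
  obtain x where "A x \<noteq> 0" using nonzero by blast
  hence "sn x \<noteq> 0" using sn_zero_imp_A_zero by blast
  hence "sn ((1 / sn x) *\<^sub>R x) = 1"
    using sn_nonneg[of x] by (simp add: sn_scaleR)
  then show ?thesis by blast
qed

lemma A_opnorm_leI:
  assumes "C \<ge> 0" and "\<And>x. sn (T x) \<le> C * sn x"
  shows "A_opnorm A T \<le> C"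
  unfolding A_opnorm_def
proof (rule cSup_least)
  show "{sn (T x) / sn x |x. x \<in> closure (range A) \<and> x \<noteq> 0} \<noteq> {}"
    using exists_range_nonzero by auto
next
  fix r assume "r \<in> {sn (T x) / sn x |x. x \<in> closure (range A) \<and> x \<noteq> 0}"
  then obtain x where r: "r = sn (T x) / sn x" by blast
  \<comment> \<open>If \<open>sn x = 0\<close>, the quotient is 0 by the convention for division,
    and \<open>C \<ge> 0\<close> settles the case.\<close>
  show "r \<le> C"
    using assms(1) assms(2)[of x] sn_nonneg[of x] unfolding r
    by (cases "sn x = 0") (simp_all add: divide_simps)
qed

lemma A_opnorm_upper:
  assumes "T \<in> A_bounded_ops A" and "x \<in> closure (range A)" "x \<noteq> 0"
  shows "sn (T x) / sn x \<le> A_opnorm A T"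
  unfolding A_opnorm_def
proof (rule cSup_upper)
  obtain l where l: "l > 0" "\<And>x. sn (T x) \<le> l * sn x"
    using assms(1) by (auto simp: A_bounded_ops_def)
  have "sn (T x) / sn x \<le> l" for x
    using l(1) l(2)[of x] sn_nonneg[of x] by (cases "sn x = 0") (simp_all add: divide_simps)
  then show "bdd_above {sn (T x) / sn x |x. x \<in> closure (range A) \<and> x \<noteq> 0}"
    by (auto intro!: bdd_aboveI[of _ l])
qed (use assms in blast)

lemma A_opnorm_nonneg:
  assumes "T \<in> A_bounded_ops A"
  shows "A_opnorm A T \<ge> 0"
proof -
  obtain x where "x \<in> closure (range A)" "x \<noteq> 0" using exists_range_nonzero by blast
  from A_opnorm_upper[OF assms this] show ?thesis
    using order_trans[OF divide_nonneg_nonneg[OF sn_nonneg sn_nonneg]] by blast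
qed

text \<open>The supremum controls vectors \<open>A z\<close> directly. Any \<open>x\<close> is
  approximated by such vectors in \<open>sn\<close>, and the constant \<open>l\<close> from
  \<open>A\<close>-boundedness controls the error.\<close>

lemma sn_le_A_opnorm:
  assumes T: "T \<in> A_bounded_ops A"
  shows "sn (T x) \<le> A_opnorm A T * sn x"
proof -
  let ?N = "A_opnorm A T"
  obtain l where Tb: "T \<in> bounded_ops" and l: "l > 0" "\<And>x. sn (T x) \<le> l * sn x"
    using T by (auto simp: A_bounded_ops_def)
  have range: "sn (T (A z)) \<le> ?N * sn (A z)" for z
  proof (cases "sn (A z) = 0")
    case True
    then show ?thesis using l(2)[of "A z"] by simp
  next
    case False
    hence "A z \<noteq> 0" using sn_scaleR[of 0 0] by auto
    then show ?thesis
      using A_opnorm_upper[OF T, of "A z"] False sn_nonneg[of "A z"]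
        closure_subset[of "range A"] by (auto simp: divide_simps)
  qed
  have approx: "sn (T x) \<le> ?N * sn x + (?N + l) * e" if "e > 0" for e
  proof -
    obtain z where z: "sn (x - A z) < e" using range_dense[OF \<open>e > 0\<close>] by blast
    have "sn (T x) \<le> sn (T (A z)) + sn (T (x - A z))"
      using sn_triangle[of "T (A z)" "T (x - A z)"] by (simp add: bounded_ops_diff[OF Tb])
    also have "\<dots> \<le> ?N * sn (A z) + l * sn (x - A z)"
      using range[of z] l(2)[of "x - A z"] by linarith
    also have "\<dots> \<le> ?N * (sn x + sn (x - A z)) + l * sn (x - A z)"
      using sn_triangle[of x "- (x - A z)"] sn_scaleR[of "-1" "x - A z"] A_opnorm_nonneg[OF T]
      by (intro add_right_mono mult_left_mono) simp_all
    also have "\<dots> = ?N * sn x + (?N + l) * sn (x - A z)"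
      by (simp add: algebra_simps)
    also have "\<dots> \<le> ?N * sn x + (?N + l) * e"
      using z l(1) A_opnorm_nonneg[OF T] by (intro add_left_mono mult_left_mono) auto
    finally show ?thesis .
  qed
  have pos: "?N + l > 0" using l(1) A_opnorm_nonneg[OF T] by linarith
  show ?thesis
  proof (rule field_le_epsilon)
    fix d :: real assume "d > 0"
    then show "sn (T x) \<le> ?N * sn x + d"
      using approx[of "d / (?N + l)"] pos by simp
  qed
qed

lemma A_inner_le_A_opnorm:
  assumes "T \<in> A_bounded_ops A"
  shows "cmod (q (T x) x) \<le> A_opnorm A T * (sn x)\<^sup>2"
  using A_Cauchy_Schwarz[of "T x" x] mult_right_mono[OF sn_le_A_opnorm[OF assms, of x] sn_nonneg[of x]]
  by (simp add: power2_eq_square mult.assoc)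

lemma A_numerical_radius_le_A_opnorm:
  assumes "T \<in> A_bounded_ops A"
  shows "A_numerical_radius A T \<le> A_opnorm A T"
  unfolding A_numerical_radius_def
proof (rule cSup_least)
  show "{cmod (q (T x) x) |x. sn x = 1} \<noteq> {}" using exists_sn_one by auto
next
  fix r assume "r \<in> {cmod (q (T x) x) |x. sn x = 1}"
  then obtain x where "r = cmod (q (T x) x)" "sn x = 1" by blast
  then show "r \<le> A_opnorm A T" using A_inner_le_A_opnorm[OF assms, of x] by simp
qed

lemma A_inner_le_A_numerical_radius:
  assumes T: "T \<in> A_bounded_ops A"
  shows "cmod (q (T x) x) \<le> A_numerical_radius A T * (sn x)\<^sup>2"
proof (cases "sn x = 0")
  case True
  \<comment> \<open>Here \<open>x\<close> cannot be normalized, but the norm estimate makes the left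
    side vanish.\<close>
  then show ?thesis using A_inner_le_A_opnorm[OF T, of x] by simp
next
  case False
  have Tb: "T \<in> bounded_ops" using T by (simp add: A_bounded_ops_def)
  define y where "y = (1 / sn x) *\<^sub>R x"
  have y1: "sn y = 1" using False sn_nonneg[of x] by (simp add: y_def sn_scaleR)
  have "cmod (q (T y) y) \<le> A_numerical_radius A T"
    unfolding A_numerical_radius_def
  proof (rule cSup_upper)
    have "cmod (q (T x) x) \<le> A_opnorm A T" if "sn x = 1" for x
      using A_inner_le_A_opnorm[OF T, of x] that by simp
    then show "bdd_above {cmod (q (T x) x) |x. sn x = 1}"
      by (auto intro!: bdd_aboveI[of _ "A_opnorm A T"])
  qed (use y1 in blast)
  moreover have "q (T y) y = q (T x) x / (of_real (sn x))\<^sup>2"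
    by (simp add: y_def bounded_ops_scaleR[OF Tb] q_simps power2_eq_square)
  ultimately show ?thesis
    using False by (simp add: norm_divide norm_power divide_simps)
qed

lemma A_spectral_radius_nonneg:
  assumes "T \<in> A_bounded_ops A"
  shows "A_spectral_radius A T \<ge> 0"
  unfolding A_spectral_radius_def
  by (intro cINF_greatest) (auto intro: A_opnorm_nonneg A_bounded_ops_funpow assms)

lemma A_spectral_radius_power_le:
  assumes T: "T \<in> A_bounded_ops A" and "n \<ge> 1"
  shows "A_spectral_radius A T ^ n \<le> A_opnorm A (T ^^ n)"
proof -
  have nonneg: "A_opnorm A (T ^^ m) \<ge> 0" for m
    by (intro A_opnorm_nonneg A_bounded_ops_funpow T)
  have "A_spectral_radius A T \<le> root n (A_opnorm A (T ^^ n))"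
    unfolding A_spectral_radius_def
  proof (rule cINF_lower)
    show "bdd_below ((\<lambda>n. root n (A_opnorm A (T ^^ n))) ` {1..})"
      using nonneg by (auto intro!: bdd_belowI[of _ 0])
  qed (use \<open>n \<ge> 1\<close> in auto)
  hence "A_spectral_radius A T ^ n \<le> root n (A_opnorm A (T ^^ n)) ^ n"
    by (intro power_mono A_spectral_radius_nonneg T)
  then show ?thesis using \<open>n \<ge> 1\<close> nonneg by simp
qed

text \<open>A bound \<open>w\<close> for \<open>T\<close> becomes \<open>w ^ (2 ^ k)\<close> for
  \<open>T ^^ (2 ^ k)\<close>, hence a norm bound with an extra factor 2 independent of
  \<open>k\<close>.\<close>

lemma A_spectral_radius_le_A_numerical_radius:
  assumes T: "T \<in> A_bounded_ops A"
  shows "A_spectral_radius A T \<le> A_numerical_radius A T"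
proof (rule dense_ge)
  \<comment> \<open>Taking \<open>w\<close> strictly above the numerical radius ensures
    \<open>w > 0\<close> even when that radius is 0.\<close>
  fix w assume w: "A_numerical_radius A T < w"
  have Tb: "T \<in> bounded_ops" using T by (simp add: A_bounded_ops_def)
  obtain x where "sn x = 1" using exists_sn_one by blast
  hence "A_numerical_radius A T \<ge> 0"
    using order_trans[OF norm_ge_zero A_inner_le_A_numerical_radius[OF T, of x]] by simp
  hence "w > 0" using w by simp
  have le: "cmod (q (T x) x) \<le> w * (sn x)\<^sup>2" for x
    using A_inner_le_A_numerical_radius[OF T, of x] w
      mult_right_mono[of "A_numerical_radius A T" w "(sn x)\<^sup>2"] by simp
  show "A_spectral_radius A T \<le> w"
  proof (rule power_bound_imp_le[OF \<open>w > 0\<close>])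
    fix k :: nat
    have "sn ((T ^^ (2 ^ k)) x) \<le> 2 * w ^ (2 ^ k) * sn x" for x
      using \<open>w > 0\<close> numerical_bound_power[OF Tb \<open>w > 0\<close> le]
      by (intro norm_le_twice_numerical_bound bounded_ops_funpow Tb) simp_all
    hence "A_opnorm A (T ^^ (2 ^ k)) \<le> 2 * w ^ (2 ^ k)"
      using \<open>w > 0\<close> by (intro A_opnorm_leI) auto
    then show "A_spectral_radius A T ^ (2 ^ k) \<le> 2 * w ^ (2 ^ k)"
      using A_spectral_radius_power_le[OF T, of "2 ^ k"] by simp
  qed
qed

end

theorem theorem2p4:
  fixes A T :: "'a::chilbert_space \<Rightarrow> 'a"
  assumes "\<exists>x::'a. x \<noteq> 0"
    and "positive_op A"
    and "A \<noteq> (\<lambda>x. 0)"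
    and "T \<in> A_bounded_ops A"
    and "A_normaloid A T"
  shows "A_spectral_radius A T = A_numerical_radius A T \<and>
    A_numerical_radius A T = A_opnorm A T"
proof -
  interpret nonzero_positive_operator A
    using assms by unfold_locales
  show ?thesis
    using A_spectral_radius_le_A_numerical_radius[OF assms(4)]
      A_numerical_radius_le_A_opnorm[OF assms(4)] assms(5)
    by (simp add: A_normaloid_def)
qed

end
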